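(* Let $n,t,d\ge 1$ be integers with $n>3t$. Let $\mathcal{A}$ be any aggregation algorithm for $n$ clients with vectors in $\mathbb{R}^d$, up to $t$ of which are Byzantine, and suppose that $\mathcal{A}$ satisfies box validity. Then the approximation ratio of $\mathcal{A}$ for the centroid is at least $$\sqrt{\tfrac12\cdot\min\left\{\left\lfloor\tfrac{n-t}{t}\right\rfloor,\,d\right\}},$$ i.e., if $\mathcal{A}$ computes an $\alpha$-approximation of the centroid, then $\alpha\ge \sqrt{\tfrac12\min\{\lfloor (n-t)/t\rfloor, d\}}$.
   Context: Model. There are $n$ clients, up to $t<n/3$ of which are Byzantine, and one trusted server. The server receives a family of $m$ vectors $(v_i)_{i\in M}$ in $\mathbb{R}^d$ (Euclidean norm and distance $\mathrm{dist}$), where $M\subseteq\{1,\dots,n\}$, $|M|=m$, $n-t\le m\le n$. An unknown set $N\subseteq M$ with $|N|\ge n-t$ is the set of non-faulty clients; the vectors of the clients in $M\setminus N$ are Byzantine and arbitrary. An aggregation algorithm $\mathcal{A}$ is a deterministic function of the received family only (it does not know $N$); its output is a vector in $\mathbb{R}^d$. A received family together with an admissible set $N$ is called a configuration. True centroid: $\mathrm{Cent}^\star=\frac1{|N|}\sum_{i\in N}v_i$. Candidate centroids: $S_{\mathrm{Cent}}$ is the set of all averages $\frac{1}{n-t}\sum_{i\in I}v_i$ with $I\subseteq M$, $|I|=n-t$. Let $\mathrm{Rad_{cov}}$ be the radius of the smallest closed Euclidean ball containing $S_{\mathrm{Cent}}$. Approximation: $\mathcal{A}$ computes an $\alpha$-approximation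 of the centroid if, in every configuration, its output $O$ satisfies $\mathrm{dist}(O,\mathrm{Cent}^\star)\le\alpha\cdot\mathrm{Rad_{cov}}$. The approximation ratio of $\mathcal{A}$ is the smallest such $\alpha$ ($\infty$ if there is none). Box validity: in every configuration, the output of $\mathcal{A}$ lies in the smallest coordinate-parallel hyperbox containing all non-faulty vectors $v_i$, $i\in N$. *)

theory Defs
  imports "HOL-Analysis.Analysis"
begin

text \<open>
  Clients are the numbers 1, ..., n.  A family \<open>(v\<^sub>i)\<close>, \<open>i \<in> M\<close>, is a partial map with
  domain \<open>M\<close>, so that a function on families depends only on what the server received:
  on \<open>M\<close> and on the vectors indexed by \<open>M\<close>.  The dimension is \<open>CARD('d)\<close>.
\<close>

type_synonym 'd family = "nat \<rightharpoonup> real ^ 'd"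

type_synonym 'd aggregation = "'d family \<Rightarrow> real ^ 'd"

definition configuration :: "nat \<Rightarrow> nat \<Rightarrow> ('d::finite) family \<Rightarrow> nat set \<Rightarrow> bool" where
  "configuration n t V N \<longleftrightarrow>
     dom V \<subseteq> {1..n} \<and> n - t \<le> card (dom V) \<and> N \<subseteq> dom V \<and> n - t \<le> card N"

definition true_centroid :: "('d::finite) family \<Rightarrow> nat set \<Rightarrow> real ^ 'd" where
  "true_centroid V N = (1 / real (card N)) *\<^sub>R (\<Sum>i\<in>N. the (V i))"

definition candidate_centroids :: "nat \<Rightarrow> nat \<Rightarrow> ('d::finite) family \<Rightarrow> (real ^ 'd) set" where
  "candidate_centroids n t V =
     {(1 / real (n - t)) *\<^sub>R (\<Sum>i\<in>I. the (V i)) | I. I \<subseteq> dom V \<and> card I = n - t}"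

text \<open>The infimum below is attained on nonempty bounded sets, see \<open>min_ball_radius_attained\<close>.\<close>

definition min_ball_radius :: "('a::euclidean_space) set \<Rightarrow> real" where
  "min_ball_radius S = Inf {r. 0 \<le> r \<and> (\<exists>c. S \<subseteq> cball c r)}"

definition rad_cov :: "nat \<Rightarrow> nat \<Rightarrow> ('d::finite) family \<Rightarrow> real" where
  "rad_cov n t V = min_ball_radius (candidate_centroids n t V)"

definition approximates_centroid ::
    "nat \<Rightarrow> nat \<Rightarrow> ('d::finite) aggregation \<Rightarrow> real \<Rightarrow> bool" where
  "approximates_centroid n t A \<alpha> \<longleftrightarrow>
     (\<forall>V N. configuration n t V N \<longrightarrow> dist (A V) (true_centroid V N) \<le> \<alpha> * rad_cov n t V)"

text \<open>The infimum of the empty set is \<open>\<infinity>\<close> in \<^typ>\<open>ereal\<close>.\<close>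

definition approximation_ratio :: "nat \<Rightarrow> nat \<Rightarrow> ('d::finite) aggregation \<Rightarrow> ereal" where
  "approximation_ratio n t A = (INF \<alpha>\<in>{\<alpha>. approximates_centroid n t A \<alpha>}. ereal \<alpha>)"

definition bounding_box :: "(real ^ 'd::finite) set \<Rightarrow> (real ^ 'd) set" where
  "bounding_box X = \<Inter>{B. (\<exists>a b. B = cbox a b) \<and> X \<subseteq> B}"

definition box_valid :: "nat \<Rightarrow> nat \<Rightarrow> ('d::finite) aggregation \<Rightarrow> bool" where
  "box_valid n t A \<longleftrightarrow>
     (\<forall>V N. configuration n t V N \<longrightarrow> A V \<in> bounding_box ((\<lambda>i. the (V i)) ` N))"

lemma min_ball_radius_attained:
  fixes S :: "('a::euclidean_space) set"
  assumes "bounded S" "S \<noteq> {}"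
  shows "0 \<le> min_ball_radius S \<and> (\<exists>c. S \<subseteq> cball c (min_ball_radius S))"
proof -
  define R where "R = {r. 0 \<le> r \<and> (\<exists>c. S \<subseteq> cball c r)}"
  define \<rho> where "\<rho> = Inf R"
  obtain x where x: "x \<in> S" using assms(2) by blast
  obtain c0 r0 where "S \<subseteq> cball c0 r0"
    using assms(1) unfolding bounded_def by (auto simp: subset_iff)
  moreover from this x have "0 \<le> r0"
    using order_trans[OF zero_le_dist[of c0 x]] by auto
  ultimately have "r0 \<in> R" by (auto simp: R_def)
  then have ne: "R \<noteq> {}" by blast
  have pos: "0 \<le> \<rho>"
    unfolding \<rho>_def using ne by (intro cInf_greatest) (auto simp: R_def)
  have "\<exists>c. S \<subseteq> cball c (\<rho> + 1 / real (Suc k))" for k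
  proof -
    have "Inf R < \<rho> + 1 / real (Suc k)" by (simp add: \<rho>_def)
    then obtain r where "r \<in> R" "r < \<rho> + 1 / real (Suc k)"
      using cInf_lessD[OF ne] by blast
    then show ?thesis
      unfolding R_def using subset_cball less_imp_le by blast
  qed
  then obtain c where c: "\<And>k. S \<subseteq> cball (c k) (\<rho> + 1 / real (Suc k))" by metis
  have "c k \<in> cball x (\<rho> + 1)" for k
  proof -
    have "dist (c k) x \<le> \<rho> + 1 / real (Suc k)" using c x by (auto simp: subset_iff)
    also have "\<dots> \<le> \<rho> + 1" by simp
    finally show ?thesis by (simp add: dist_commute)
  qed
  then obtain l s where s: "strict_mono (s :: nat \<Rightarrow> nat)" and l: "(c \<circ> s) \<longlonglongrightarrow> l"
    using compact_cball[of x "\<rho> + 1"] unfolding compact_def by blast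
  have "dist l y \<le> \<rho>" if "y \<in> S" for y
  proof (rule LIMSEQ_le)
    show "(\<lambda>k. dist ((c \<circ> s) k) y) \<longlonglongrightarrow> dist l y"
      by (intro tendsto_dist l tendsto_const)
    have "(\<lambda>k. \<rho> + 1 / real (Suc k)) \<longlonglongrightarrow> \<rho> + 0"
      by (intro tendsto_add tendsto_const LIMSEQ_Suc[OF lim_1_over_n])
    from LIMSEQ_subseq_LIMSEQ[OF this s]
    show "(\<lambda>k. \<rho> + 1 / real (Suc (s k))) \<longlonglongrightarrow> \<rho>" by (simp add: o_def)
    show "\<exists>K. \<forall>k\<ge>K. dist ((c \<circ> s) k) y \<le> \<rho> + 1 / real (Suc (s k))"
      using c that by (auto simp: subset_iff)
  qed
  then have "S \<subseteq> cball l \<rho>" by auto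
  then show ?thesis
    using pos unfolding min_ball_radius_def \<rho>_def R_def by blast
qed

end

theory Submission
  imports Defs
begin

text \<open>
  Put \<open>k = min \<lfloor>(n - t) / t\<rfloor> d\<close>, let \<open>k\<close> disjoint groups of \<open>t\<close> clients each send a different
  unit vector, and let all other clients, at least \<open>t\<close> of them, send \<open>0\<close>.  Any single group may be
  the Byzantine one, so box validity forces the first \<open>k\<close> coordinates of the output to vanish.  If
  instead \<open>t\<close> of the zero vectors are Byzantine, the true centroid has those coordinates equal to
  \<open>t / (n - t)\<close>, at distance at least \<open>\<surd>k \<cdot> t / (n - t)\<close> from the output.  Every candidate
  centroid omits \<open>t\<close> vectors of norm at most 1, so it is within \<open>t / (n - t)\<close> of this true
  centroid.  The ratio is therefore even at least \<open>\<surd>k\<close>.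
\<close>

text \<open>A box around \<open>X\<close> can be flattened to the single value \<open>a\<close> in
  coordinate \<open>c\<close> and still contains \<open>X\<close>. Boundedness supplies the box to
  start from.\<close>

lemma bounding_box_component_eq:
  fixes X :: "(real ^ 'd::finite) set"
  assumes "bounded X" and "x \<in> bounding_box X" and "\<And>y. y \<in> X \<Longrightarrow> y $ c = a"
  shows "x $ c = a"
proof -
  obtain l u where lu: "X \<subseteq> cbox l u"
    using bounded_subset_cbox_symmetric[OF assms(1)] by blast
  let ?B = "cbox (\<chi> i. if i = c then a else l $ i) (\<chi> i. if i = c then a else u $ i)"
  have "X \<subseteq> ?B"
    using lu assms(3) by (auto simp: mem_box_cart subset_iff)
  then have "x \<in> ?B"
    using assms(2) unfolding bounding_box_def by blast
  then have "a \<le> x $ c" "x $ c \<le> a"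
    by (auto simp: mem_box_cart dest: spec[of _ c])
  then show ?thesis by simp
qed

lemma box_valid_component_eq:
  assumes "box_valid n t A" and "configuration n t V N"
    and "\<And>i. i \<in> N \<Longrightarrow> the (V i) $ c = a"
  shows "A V $ c = a"
proof -
  have "finite N"
    using assms(2) unfolding configuration_def
    by (elim conjE) (blast intro: finite_subset[OF _ finite_atLeastAtMost])
  then have "bounded ((\<lambda>i. the (V i)) ` N)"
    by (intro finite_imp_bounded finite_imageI)
  moreover have "A V \<in> bounding_box ((\<lambda>i. the (V i)) ` N)"
    using assms(1,2) unfolding box_valid_def by blast
  ultimately show ?thesis
    by (rule bounding_box_component_eq) (use assms(3) in blast)
qed

lemma min_ball_radius_le:
  assumes "S \<subseteq> cball c r" "0 \<le> r"
  shows "min_ball_radius S \<le> r"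
  unfolding min_ball_radius_def
  by (rule cInf_lower) (use assms in \<open>auto intro!: bdd_belowI[of _ 0]\<close>)

text \<open>The covering ball makes the set of radii nonempty, so that its lower bound 0 passes to
  the infimum.\<close>

lemma min_ball_radius_nonneg:
  assumes "S \<subseteq> cball c r" "0 \<le> r"
  shows "0 \<le> min_ball_radius S"
  unfolding min_ball_radius_def
  by (rule cInf_greatest) (use assms in auto)

text \<open>The two sums differ by the \<open>t\<close> vectors that \<open>I\<close> omits. The sum
  over all \<open>n\<close> clients is divided by \<open>n - t\<close> because it will be a true
  centroid whose \<open>t\<close> missing vectors are zero.\<close>

lemma dist_candidate_centroid_le:
  fixes V :: "('d::finite) family"
  assumes "dom V = {1..n}" "t \<le> n" and x: "x \<in> candidate_centroids n t V"
    and le1: "\<And>j. j \<in> {1..n} \<Longrightarrow> norm (the (V j)) \<le> 1"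
  shows "dist ((1 / real (n - t)) *\<^sub>R (\<Sum>j=1..n. the (V j))) x \<le> real t / real (n - t)"
proof -
  obtain I where I: "I \<subseteq> {1..n}" "card I = n - t"
    and xI: "x = (1 / real (n - t)) *\<^sub>R (\<Sum>j\<in>I. the (V j))"
    using x assms(1) unfolding candidate_centroids_def by auto
  have fin: "finite I" using I(1) finite_subset by blast
  have "(\<Sum>j=1..n. the (V j)) - (\<Sum>j\<in>I. the (V j)) = (\<Sum>j\<in>{1..n} - I. the (V j))"
    using I(1) by (simp add: sum_diff)
  then have "dist ((1 / real (n - t)) *\<^sub>R (\<Sum>j=1..n. the (V j))) x
      = norm (\<Sum>j\<in>{1..n} - I. the (V j)) / real (n - t)"
    unfolding xI dist_norm scaleR_diff_right[symmetric] by simp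
  also have "norm (\<Sum>j\<in>{1..n} - I. the (V j)) \<le> (\<Sum>j\<in>{1..n} - I. 1)"
    by (rule sum_norm_le) (use le1 in auto)
  also have "\<dots> = real t"
    using I fin assms(2) by (simp add: card_Diff_subset)
  finally show ?thesis by (simp add: divide_right_mono)
qed

lemma norm_ge_sqrt_card:
  fixes x :: "real ^ 'd::finite"
  assumes "\<And>c. c \<in> D \<Longrightarrow> \<bar>x $ c\<bar> = b" and "0 \<le> b"
  shows "sqrt (real (card D)) * b \<le> norm x"
proof -
  have "(x $ c)\<^sup>2 = b\<^sup>2" if "c \<in> D" for c
    using assms(1)[OF that] power2_abs[of "x $ c"] by metis
  then have "(sqrt (real (card D)) * b)\<^sup>2 = (\<Sum>c\<in>D. (x $ c)\<^sup>2)"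
    by (simp add: power_mult_distrib)
  also have "\<dots> \<le> (\<Sum>c\<in>UNIV. (x $ c)\<^sup>2)"
    by (rule sum_mono2) auto
  also have "\<dots> = (norm x)\<^sup>2"
    by (simp add: norm_vec_def L2_set_def sum_nonneg)
  finally show ?thesis by (rule power2_le_imp_le) simp
qed

text \<open>Group \<open>i < k\<close> consists of the clients \<open>i * t + 1, \<dots>, i * t + t\<close>.\<close>

definition group_family :: "nat \<Rightarrow> nat \<Rightarrow> nat \<Rightarrow> (nat \<Rightarrow> 'd) \<Rightarrow> ('d::finite) family" where
  "group_family n t k g = (\<lambda>j. if j \<in> {1..n}
     then Some (if (j - 1) div t < k then axis (g ((j - 1) div t)) 1 else 0) else None)"

lemma dom_group_family [simp]: "dom (group_family n t k g) = {1..n}"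
  by (auto simp: group_family_def dom_def)

lemma the_group_family:
  "j \<in> {1..n} \<Longrightarrow> the (group_family n t k g j) =
     (if (j - 1) div t < k then axis (g ((j - 1) div t)) 1 else 0)"
  by (simp add: group_family_def)

lemma group_family_component:
  assumes "inj_on g {..<k}" "i < k" "j \<in> {1..n}"
  shows "the (group_family n t k g j) $ g i = (if (j - 1) div t = i then 1 else 0)"
  using assms by (auto simp: the_group_family axis_def inj_on_def)

text \<open>The bound \<open>m\<close> is general because groups are counted both among all
  \<open>n\<close> clients and among the first \<open>n - t\<close>.\<close>

lemma group_eq:
  fixes t :: nat
  assumes "t \<ge> 1" "i < k" "k * t \<le> m"
  shows "{j \<in> {1..m}. (j - 1) div t = i} = {i * t + 1..i * t + t}"
proof -
  have "Suc i * t \<le> k * t"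
    using assms(2) by (intro mult_right_mono) auto
  then have "i * t + t \<le> m" using assms(3) by simp
  moreover have "(j - 1) div t = i \<longleftrightarrow> i * t \<le> j - 1 \<and> j - 1 < i * t + t" for j
    using less_eq_div_iff_mult_less_eq[of t i "j - 1"]
      div_less_iff_less_mult[of t "j - 1" "Suc i"] assms(1) by auto
  ultimately have "j \<in> {1..m} \<and> (j - 1) div t = i \<longleftrightarrow> j \<in> {i * t + 1..i * t + t}" for j
    by (simp only: atLeastAtMost_iff) linarith
  then show ?thesis by blast
qed

lemma approximates_centroid_ge_sqrt:
  fixes A :: "('d::finite) aggregation"
  assumes "t \<ge> 1" "n > t" "box_valid n t A" "approximates_centroid n t A \<alpha>"
    and "k * t \<le> n - t" "k \<ge> 1" "k \<le> CARD('d)"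
  shows "\<alpha> \<ge> sqrt (real k)"
proof -
  obtain g :: "nat \<Rightarrow> 'd" where g: "inj_on g {..<k}"
    using card_le_inj[of "{..<k}" "UNIV :: 'd set"] assms(7) by auto
  define V where "V = group_family n t k g"
  define b where "b = real t / real (n - t)"
  have b: "b > 0" using assms(1,2) by (simp add: b_def)
  have zero: "A V $ g i = 0" if i: "i < k" for i
  proof (rule box_valid_component_eq[OF assms(3)])
    \<comment> \<open>Group \<open>i\<close> plays the Byzantine clients. As \<open>g\<close> is
      injective, no other client is nonzero in coordinate \<open>g i\<close>.\<close>
    let ?G = "{j \<in> {1..n}. (j - 1) div t = i}"
    have "card ?G = t"
      by (subst group_eq[OF assms(1) i]) (use assms(5) in auto)
    moreover have "card ({1..n} - ?G) = n - card ?G"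
      by (subst card_Diff_subset) auto
    ultimately show "configuration n t V ({1..n} - ?G)"
      unfolding configuration_def V_def dom_group_family by (metis Diff_subset card_atLeastAtMost
        diff_Suc_1 diff_le_self le_refl subset_refl)
    show "the (V j) $ g i = 0" if "j \<in> {1..n} - ?G" for j
      using that g i unfolding V_def by (subst group_family_component) auto
  qed
  \<comment> \<open>Since \<open>k * t \<le> n - t\<close>, all groups lie among the first
    \<open>n - t\<close> clients; the last \<open>t\<close>, now Byzantine, send 0.\<close>
  let ?N = "{1..n - t}"
  have conf: "configuration n t V ?N"
    by (auto simp: configuration_def V_def)
  \<comment> \<open>Adding the zero vectors of the last \<open>t\<close> clients gives the form that
    is comparable with every candidate centroid.\<close>
  have C: "true_centroid V ?N = (1 / real (n - t)) *\<^sub>R (\<Sum>j=1..n. the (V j))"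
  proof -
    have "the (V j) = 0" if "j \<in> {1..n} - ?N" for j
    proof -
      have "k * t \<le> j - 1" using that assms(5) by auto
      then have "k \<le> (j - 1) div t" using assms(1) by (simp add: less_eq_div_iff_mult_less_eq)
      then show ?thesis using that by (simp add: V_def the_group_family)
    qed
    then have "(\<Sum>j\<in>?N. the (V j)) = (\<Sum>j=1..n. the (V j))"
      by (intro sum.mono_neutral_left) auto
    then show ?thesis by (simp add: true_centroid_def)
  qed
  have comp: "true_centroid V ?N $ g i = b" if i: "i < k" for i
  proof -
    have "(\<Sum>j\<in>?N. the (V j) $ g i) = (\<Sum>j\<in>?N. if (j - 1) div t = i then 1 else 0)"
      using g i unfolding V_def by (intro sum.cong refl group_family_component) auto
    also have "\<dots> = real (card {j \<in> ?N. (j - 1) div t = i})"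
      by (simp add: sum.If_cases Int_def)
    also have "\<dots> = real t"
      by (subst group_eq[OF assms(1) i assms(5)]) simp
    finally show ?thesis by (simp add: true_centroid_def b_def)
  qed
  have sub: "candidate_centroids n t V \<subseteq> cball (true_centroid V ?N) b"
  proof
    fix x assume x: "x \<in> candidate_centroids n t V"
    show "x \<in> cball (true_centroid V ?N) b"
      unfolding C b_def mem_cball
      by (rule dist_candidate_centroid_le[OF _ _ x])
        (use assms(2) in \<open>auto simp: V_def the_group_family\<close>)
  qed
  have rad: "rad_cov n t V \<le> b" "0 \<le> rad_cov n t V"
    using min_ball_radius_le[OF sub] min_ball_radius_nonneg[OF sub] b by (auto simp: rad_cov_def)
  have "sqrt (real (card (g ` {..<k}))) * b \<le> norm (A V - true_centroid V ?N)"
    by (rule norm_ge_sqrt_card) (use zero comp b in auto)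
  also have "\<dots> \<le> \<alpha> * rad_cov n t V"
    using assms(4) conf unfolding approximates_centroid_def dist_norm by blast
  finally have *: "sqrt (real k) * b \<le> \<alpha> * rad_cov n t V"
    using g by (simp add: card_image)
  \<comment> \<open>The sign of \<open>\<alpha>\<close> is not given. Positivity of the left side,
    from \<open>k \<ge> 1\<close>, forces \<open>0 \<le> \<alpha>\<close>, so that
    \<open>rad_cov\<close> may be replaced by its upper bound \<open>b\<close>.\<close>
  have "0 < sqrt (real k) * b" using assms(6) b by simp
  with * have "0 < \<alpha> * rad_cov n t V" by linarith
  with rad(2) have "0 \<le> \<alpha>" by (auto simp: zero_less_mult_iff)
  with * rad(1) have "sqrt (real k) * b \<le> \<alpha> * b"
    by (meson mult_left_mono order_trans)
  with b show ?thesis by simp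
qed

theorem lemma3p11:
  fixes n t :: nat and A :: "('d::finite) aggregation"
  assumes "n \<ge> 1" and "t \<ge> 1" and "n > 3 * t"
    and "box_valid n t A"
  shows "approximation_ratio n t A \<ge> ereal (sqrt (1 / 2 * real (min ((n - t) div t) CARD('d))))
    \<and> (\<forall>\<alpha>. approximates_centroid n t A \<alpha>
          \<longrightarrow> \<alpha> \<ge> sqrt (1 / 2 * real (min ((n - t) div t) CARD('d))))"
proof -
  define k where "k = min ((n - t) div t) CARD('d)"
  have "k * t \<le> (n - t) div t * t" by (simp add: k_def)
  then have "k * t \<le> n - t" by (meson div_times_less_eq_dividend order_trans)
  moreover have "1 \<le> (n - t) div t"
    using assms(2,3) by (simp add: less_eq_div_iff_mult_less_eq)
  then have "1 \<le> k" by (simp add: k_def Suc_leI)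
  moreover have "k \<le> CARD('d)" by (simp add: k_def)
  ultimately have "sqrt (real k) \<le> \<alpha>" if "approximates_centroid n t A \<alpha>" for \<alpha>
    using approximates_centroid_ge_sqrt[OF assms(2) _ assms(4) that] assms(3) by simp
  \<comment> \<open>The factor 1/2 of the claim only weakens the bound already obtained.\<close>
  moreover have "sqrt (1 / 2 * real k) \<le> sqrt (real k)" by simp
  ultimately have "sqrt (1 / 2 * real k) \<le> \<alpha>" if "approximates_centroid n t A \<alpha>" for \<alpha>
    using that order_trans by blast
  then show ?thesis
    unfolding approximation_ratio_def k_def[symmetric] by (auto intro!: INF_greatest)
qed

end
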